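(* Let $\langle\cdot,\cdot\rangle$ be an invariant symmetric bilinear form on $\mathfrak g$, extended pointwise to $\mathfrak g$-valued functions and 1-forms on $\Sigma$. Let $\omega$ be a meromorphic $\mathfrak g$-valued 1-form on $\Sigma$, holomorphic outside $\Pi\cup\Gamma$, which at every $\gamma\in\Gamma$ has, in a local coordinate $z$ centered at $\gamma$, the expansion $\omega=\left(\frac{h_\gamma}{z}+\omega_0+\omega_1z+\dots\right)dz$ with all $\omega_l\in\mathfrak g_0$ (the degree $0$ subspace of the grading given by $h_\gamma$). Then for all $L,L'\in\mathcal L$ the meromorphic 1-form $\langle L,(d-\mathrm{ad}\,\omega)L'\rangle$ is holomorphic at every point of $\Gamma$ (hence holomorphic outside $\{P_1,\dots,P_N\}\cup\{Q_1,\dots,Q_M\}$).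
   Context: Let $\mathfrak g$ be a complex semisimple Lie algebra with Cartan subalgebra $\mathfrak h$. An element $h\in\mathfrak h$ with $\alpha_i(h)\in\mathbb Z_{\ge0}$ for all simple roots $\alpha_i$ defines a $\mathbb Z$-grading $\mathfrak g=\bigoplus_{p=-k}^k\mathfrak g_p$, $\mathfrak g_p=\{X\in\mathfrak g:(\mathrm{ad}\,h)X=pX\}$, $k=\max\{p:\mathfrak g_p\neq0\}$, and a filtration $\tilde{\mathfrak g}_p=\bigoplus_{q=-k}^{p}\mathfrak g_q$. Let $\Sigma$ be a compact Riemann surface of genus $g$ with disjoint finite sets $\Pi=\{P_1,\dots,P_N\}\cup\{Q_1,\dots,Q_M\}$ and $\Gamma$. For each $\gamma\in\Gamma$ fix such a grading element $h_\gamma$ (all of depth $k$). $\mathcal L$ is the space of meromorphic maps $L:\Sigma\to\mathfrak g$, holomorphic outside $\Pi\cup\Gamma$, such that at each $\gamma\in\Gamma$, in a local coordinate $z$ centered at $\gamma$, $L(z)=\sum_{p\ge -k}L_pz^p$ with $L_p\in\tilde{\mathfrak g}_p$ (for the grading given by $h_\gamma$). Here $(\mathrm{ad}\,\omega)L'$ denotes the 1-form $[\omega,L']$. *)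

theory Defs
  imports "HOL-Analysis.Analysis"
begin

text \<open>The complex Lie algebra g is modelled as the finite-dimensional complex vector space
  complex^'n with a bracket br.  Subspaces, spans etc. are taken over the complex numbers
  (locale interpretation vec of Cartesian_Space).\<close>

definition cbilinear :: "(complex^'n \<Rightarrow> complex^'n \<Rightarrow> complex) \<Rightarrow> bool" where
  "cbilinear f \<longleftrightarrow>
     (\<forall>y. Vector_Spaces.linear (*s) (*) (\<lambda>x. f x y)) \<and>
     (\<forall>x. Vector_Spaces.linear (*s) (*) (\<lambda>y. f x y))"

definition lie_algebra :: "(complex^'n \<Rightarrow> complex^'n \<Rightarrow> complex^'n) \<Rightarrow> bool" where
  "lie_algebra br \<longleftrightarrow>
     (\<forall>y. Vector_Spaces.linear (*s) (*s) (\<lambda>x. br x y)) \<and>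
     (\<forall>x. Vector_Spaces.linear (*s) (*s) (\<lambda>y. br x y)) \<and>
     (\<forall>x. br x x = 0) \<and>
     (\<forall>x y z. br x (br y z) + br y (br z x) + br z (br x y) = 0)"

definition lie_ideal :: "(complex^'n \<Rightarrow> complex^'n \<Rightarrow> complex^'n) \<Rightarrow> (complex^'n) set \<Rightarrow> bool" where
  "lie_ideal br I \<longleftrightarrow> vec.subspace I \<and> (\<forall>x\<in>I. \<forall>y. br y x \<in> I)"

fun derived_series :: "(complex^'n \<Rightarrow> complex^'n \<Rightarrow> complex^'n) \<Rightarrow> (complex^'n) set \<Rightarrow> nat \<Rightarrow> (complex^'n) set" where
  "derived_series br I 0 = I"
| "derived_series br I (Suc m) =
     vec.span {br x y | x y. x \<in> derived_series br I m \<and> y \<in> derived_series br I m}"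

definition lie_solvable :: "(complex^'n \<Rightarrow> complex^'n \<Rightarrow> complex^'n) \<Rightarrow> (complex^'n) set \<Rightarrow> bool" where
  "lie_solvable br I \<longleftrightarrow> (\<exists>m. derived_series br I m = {0})"

text \<open>Semisimple: a Lie algebra whose only solvable ideal is 0 (radical is zero).\<close>
definition semisimple_lie :: "(complex^'n \<Rightarrow> complex^'n \<Rightarrow> complex^'n) \<Rightarrow> bool" where
  "semisimple_lie br \<longleftrightarrow> lie_algebra br \<and>
     (\<forall>I. lie_ideal br I \<and> lie_solvable br I \<longrightarrow> I = {0})"

definition ad_semisimple :: "(complex^'n \<Rightarrow> complex^'n \<Rightarrow> complex^'n) \<Rightarrow> complex^'n \<Rightarrow> bool" where
  "ad_semisimple br x \<longleftrightarrow> vec.span {v. \<exists>c. br x v = c *s v} = UNIV"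

definition toral_subalgebra :: "(complex^'n \<Rightarrow> complex^'n \<Rightarrow> complex^'n) \<Rightarrow> (complex^'n) set \<Rightarrow> bool" where
  "toral_subalgebra br T \<longleftrightarrow> vec.subspace T \<and> (\<forall>x\<in>T. \<forall>y\<in>T. br x y \<in> T) \<and>
     (\<forall>x\<in>T. ad_semisimple br x)"

text \<open>Cartan subalgebra of a semisimple Lie algebra: a maximal toral subalgebra.\<close>
definition cartan_subalgebra :: "(complex^'n \<Rightarrow> complex^'n \<Rightarrow> complex^'n) \<Rightarrow> (complex^'n) set \<Rightarrow> bool" where
  "cartan_subalgebra br H \<longleftrightarrow> toral_subalgebra br H \<and>
     (\<forall>T. toral_subalgebra br T \<and> H \<subseteq> T \<longrightarrow> T = H)"

text \<open>Roots relative to H: nonzero functionals on H (represented as functions vanishing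
  off H) with a nonzero simultaneous eigenvector.\<close>
definition lie_root :: "(complex^'n \<Rightarrow> complex^'n \<Rightarrow> complex^'n) \<Rightarrow> (complex^'n) set \<Rightarrow> (complex^'n \<Rightarrow> complex) \<Rightarrow> bool" where
  "lie_root br H \<alpha> \<longleftrightarrow> (\<forall>x. x \<notin> H \<longrightarrow> \<alpha> x = 0) \<and> (\<exists>y\<in>H. \<alpha> y \<noteq> 0) \<and>
     (\<exists>x. x \<noteq> 0 \<and> (\<forall>y\<in>H. br y x = \<alpha> y *s x))"

text \<open>A base (set of simple roots).\<close>
definition root_base :: "(complex^'n \<Rightarrow> complex^'n \<Rightarrow> complex^'n) \<Rightarrow> (complex^'n) set \<Rightarrow> (complex^'n \<Rightarrow> complex) set \<Rightarrow> bool" where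
  "root_base br H \<Delta> \<longleftrightarrow> finite \<Delta> \<and> (\<forall>\<alpha>\<in>\<Delta>. lie_root br H \<alpha>) \<and>
     (\<forall>c. (\<forall>y\<in>H. (\<Sum>\<alpha>\<in>\<Delta>. c \<alpha> * \<alpha> y) = 0) \<longrightarrow> (\<forall>\<alpha>\<in>\<Delta>. c \<alpha> = 0)) \<and>
     (\<forall>\<beta>. lie_root br H \<beta> \<longrightarrow> (\<exists>m :: _ \<Rightarrow> int. (\<forall>y\<in>H. \<beta> y = (\<Sum>\<alpha>\<in>\<Delta>. of_int (m \<alpha>) * \<alpha> y)) \<and>
        ((\<forall>\<alpha>\<in>\<Delta>. m \<alpha> \<ge> 0) \<or> (\<forall>\<alpha>\<in>\<Delta>. m \<alpha> \<le> 0))))"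

text \<open>Grading element: h in a Cartan subalgebra H with alpha_i(h) in Z_{>=0} for the simple roots
  of some base.\<close>
definition grading_element :: "(complex^'n \<Rightarrow> complex^'n \<Rightarrow> complex^'n) \<Rightarrow> (complex^'n) set \<Rightarrow> complex^'n \<Rightarrow> bool" where
  "grading_element br H h \<longleftrightarrow> cartan_subalgebra br H \<and> h \<in> H \<and>
     (\<exists>\<Delta>. root_base br H \<Delta> \<and> (\<forall>\<alpha>\<in>\<Delta>. \<exists>m::nat. \<alpha> h = of_nat m))"

text \<open>g_p = eigenspace of ad h with eigenvalue p.\<close>
definition grade :: "(complex^'n \<Rightarrow> complex^'n \<Rightarrow> complex^'n) \<Rightarrow> complex^'n \<Rightarrow> int \<Rightarrow> (complex^'n) set" where
  "grade br h p = {x. br h x = of_int p *s x}"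

definition grading_depth :: "(complex^'n \<Rightarrow> complex^'n \<Rightarrow> complex^'n) \<Rightarrow> complex^'n \<Rightarrow> int" where
  "grading_depth br h = Max {p. grade br h p \<noteq> {0}}"

text \<open>Filtration: tilde g_p = g_{-k} + ... + g_p.\<close>
definition filtration :: "(complex^'n \<Rightarrow> complex^'n \<Rightarrow> complex^'n) \<Rightarrow> complex^'n \<Rightarrow> int \<Rightarrow> (complex^'n) set" where
  "filtration br h p = vec.span (\<Union>q\<in>{- grading_depth br h..p}. grade br h q)"

definition invariant_form :: "(complex^'n \<Rightarrow> complex^'n \<Rightarrow> complex^'n) \<Rightarrow> (complex^'n \<Rightarrow> complex^'n \<Rightarrow> complex) \<Rightarrow> bool" where
  "invariant_form br B \<longleftrightarrow> cbilinear B \<and> (\<forall>x y. B x y = B y x) \<and>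
     (\<forall>x y z. B (br x y) z = B x (br y z))"

text \<open>Componentwise complex derivative of a g-valued function.\<close>
definition vderiv :: "(complex \<Rightarrow> complex^'n) \<Rightarrow> complex \<Rightarrow> complex^'n" where
  "vderiv f z = (\<chi> i. deriv (\<lambda>u. f u $ i) z)"

end

theory Submission
  imports Defs "HOL-Complex_Analysis.Cauchy_Integral_Formula"
begin

text \<open>The eigenvalues of ad h are bounded, so Lagrange interpolation in ad h yields the projections
  onto the graded pieces g_s. The filtration condition says that the g_s-component of L is
  z^s m_s(z) with m_s holomorphic at 0, and likewise L' has components z^t m'_t(z). On z^t m'_t
  the pole h/z of \<omega> acts as t/z and cancels the derivative of z^t, so (d - ad \<omega>) L' is
  \<Sum>_t z^t Y_t with Y_t holomorphic and g_t-valued, the regular part of \<omega> being g_0-valued. An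
  invariant form pairs g_s trivially with g_t unless s + t = 0, so all powers of z cancel in
  \<langle>L, (d - ad \<omega>) L'\<rangle> = \<Sum>_s \<langle>m_s, Y_(-s)\<rangle>, which is holomorphic.\<close>

lemma vs_linear_scale: "Vector_Spaces.linear s1 s2 T \<Longrightarrow> T (s1 c x) = s2 c (T x)"
  unfolding Vector_Spaces.linear_iff by blast

lemma vs_linear_sum: "Vector_Spaces.linear s1 s2 T \<Longrightarrow> T (sum g A) = (\<Sum>a\<in>A. T (g a))"
  by (metis Vector_Spaces.linear_iff_module_hom module_hom.sum)

lemma vs_linear_neg: "Vector_Spaces.linear s1 s2 T \<Longrightarrow> T (- x) = - T x"
  by (metis Vector_Spaces.linear_iff_module_hom module_hom.neg)

lemma vec_linear_bounded_linear:
  fixes f :: "complex^'n \<Rightarrow> complex^'m"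
  assumes "Vector_Spaces.linear (*s) (*s) f"
  shows "bounded_linear f"
proof -
  have scaleR: "c *\<^sub>R x = complex_of_real c *s x" for c and x :: "complex^'k"
    by (simp add: vec_eq_iff scaleR_conv_of_real[where 'a=complex])
  have "linear f"
    using assms unfolding Vector_Spaces.linear_iff Real_Vector_Spaces.linear_iff by (simp add: scaleR)
  then show ?thesis by (simp add: linear_conv_bounded_linear)
qed

lemma linear_cart_basis_expansion:
  fixes T :: "complex^'n \<Rightarrow> 'a::ab_group_add"
  assumes "Vector_Spaces.linear (*s) s2 T"
  shows "T x = (\<Sum>j\<in>UNIV. s2 (x $ j) (T (axis j 1)))"
proof -
  have "T x = T (\<Sum>j\<in>UNIV. x $ j *s axis j 1)" by (simp add: basis_expansion)
  also have "\<dots> = (\<Sum>j\<in>UNIV. s2 (x $ j) (T (axis j 1)))"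
    using assms by (simp add: vs_linear_sum vs_linear_scale)
  finally show ?thesis .
qed

lemma vec_linear_component_expansion:
  fixes T :: "complex^'n \<Rightarrow> complex^'m"
  assumes "Vector_Spaces.linear (*s) (*s) T"
  shows "T x $ i = (\<Sum>j\<in>UNIV. x $ j * T (axis j 1) $ i)"
  by (subst linear_cart_basis_expansion[OF assms]) (simp add: sum_component)

lemma bilinear_cart_basis_expansion:
  fixes f :: "complex^'n \<Rightarrow> complex^'n \<Rightarrow> 'a::ab_group_add"
  assumes "\<And>y. Vector_Spaces.linear (*s) s2 (\<lambda>x. f x y)" "\<And>x. Vector_Spaces.linear (*s) s2 (f x)"
  shows "f x y = (\<Sum>i\<in>UNIV. s2 (x $ i) (\<Sum>j\<in>UNIV. s2 (y $ j) (f (axis i 1) (axis j 1))))"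
proof -
  have "f x y = (\<Sum>i\<in>UNIV. s2 (x $ i) (f (axis i 1) y))"
    by (rule linear_cart_basis_expansion[OF assms(1)])
  also have "\<dots> = (\<Sum>i\<in>UNIV. s2 (x $ i) (\<Sum>j\<in>UNIV. s2 (y $ j) (f (axis i 1) (axis j 1))))"
    by (subst linear_cart_basis_expansion[OF assms(2)]) rule
  finally show ?thesis .
qed

definition vec_holomorphic_on :: "(complex \<Rightarrow> complex^'n) \<Rightarrow> complex set \<Rightarrow> bool" where
  "vec_holomorphic_on f S \<longleftrightarrow> (\<forall>i. (\<lambda>z. f z $ i) holomorphic_on S)"

lemma vec_holomorphic_on_subset:
  "vec_holomorphic_on f S \<Longrightarrow> T \<subseteq> S \<Longrightarrow> vec_holomorphic_on f T"
  unfolding vec_holomorphic_on_def by (blast intro: holomorphic_on_subset)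

lemma vec_holomorphic_on_diff:
  "vec_holomorphic_on f S \<Longrightarrow> vec_holomorphic_on g S \<Longrightarrow> vec_holomorphic_on (\<lambda>z. f z - g z) S"
  unfolding vec_holomorphic_on_def by (auto intro!: holomorphic_intros)

lemma vec_holomorphic_on_scale:
  "c holomorphic_on S \<Longrightarrow> vec_holomorphic_on f S \<Longrightarrow> vec_holomorphic_on (\<lambda>z. c z *s f z) S"
  unfolding vec_holomorphic_on_def by (auto intro!: holomorphic_intros)

lemma vec_holomorphic_on_bilinear:
  fixes f :: "complex^'n \<Rightarrow> complex^'n \<Rightarrow> complex^'m"
  assumes "\<And>y. Vector_Spaces.linear (*s) (*s) (\<lambda>x. f x y)" "\<And>x. Vector_Spaces.linear (*s) (*s) (f x)"
    and "vec_holomorphic_on g S" "vec_holomorphic_on k S"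
  shows "vec_holomorphic_on (\<lambda>z. f (g z) (k z)) S"
  using assms(3,4) unfolding vec_holomorphic_on_def
  by (subst bilinear_cart_basis_expansion[OF assms(1,2)],
      simp only: sum_component vector_scalar_mult_def vec_lambda_beta,
      intro allI holomorphic_on_sum holomorphic_on_mult holomorphic_on_const) blast+

lemma holomorphic_on_bilinear:
  fixes f :: "complex^'n \<Rightarrow> complex^'n \<Rightarrow> complex"
  assumes "\<And>y. Vector_Spaces.linear (*s) (*) (\<lambda>x. f x y)" "\<And>x. Vector_Spaces.linear (*s) (*) (f x)"
    and "vec_holomorphic_on g S" "vec_holomorphic_on k S"
  shows "(\<lambda>z. f (g z) (k z)) holomorphic_on S"
  using assms(3,4) unfolding vec_holomorphic_on_def
  by (subst bilinear_cart_basis_expansion[OF assms(1,2)],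
      intro holomorphic_on_sum holomorphic_on_mult holomorphic_on_const) blast+

lemma vec_holomorphic_on_vderiv:
  "open S \<Longrightarrow> vec_holomorphic_on f S \<Longrightarrow> vec_holomorphic_on (vderiv f) S"
  unfolding vec_holomorphic_on_def vderiv_def by (auto intro!: holomorphic_intros)

lemma vec_holomorphic_on_component_derivative:
  assumes "vec_holomorphic_on f S" "open S" "z \<in> S"
  shows "((\<lambda>u. f u $ i) has_field_derivative vderiv f z $ i) (at z)"
proof -
  have "(\<lambda>u. f u $ i) holomorphic_on S" using assms(1) unfolding vec_holomorphic_on_def by blast
  then have "(\<lambda>u. f u $ i) field_differentiable (at z)"
    using assms(2,3) holomorphic_on_imp_differentiable_at by blast
  then show ?thesis by (simp add: vderiv_def DERIV_deriv_iff_field_differentiable)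
qed

lemma vderiv_linear:
  assumes "Vector_Spaces.linear (*s) (*s) T" "vec_holomorphic_on f S" "open S" "z \<in> S"
  shows "vderiv (\<lambda>u. T (f u)) z = T (vderiv f z)"
proof -
  \<comment> \<open>naming the matrix entries stops the expansion of \<open>T\<close> from rewriting itself\<close>
  define M where "M j i = T (axis j 1) $ i" for j i
  have T: "T x $ i = (\<Sum>j\<in>UNIV. x $ j * M j i)" for x i
    unfolding M_def by (rule vec_linear_component_expansion[OF assms(1)])
  have "((\<lambda>u. \<Sum>j\<in>UNIV. f u $ j * M j i) has_field_derivative
          (\<Sum>j\<in>UNIV. vderiv f z $ j * M j i)) (at z)" for i
    by (intro DERIV_sum DERIV_cmult_right vec_holomorphic_on_component_derivative[OF assms(2-4)])
  then show ?thesis by (simp add: vderiv_def vec_eq_iff T DERIV_imp_deriv)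
qed

lemma vderiv_cong:
  assumes "open S" "z \<in> S" "\<And>u. u \<in> S \<Longrightarrow> f u = g u"
  shows "vderiv f z = vderiv g z"
proof -
  have "eventually (\<lambda>u. f u = g u) (nhds z)"
    unfolding eventually_nhds using assms by blast
  then have "deriv (\<lambda>u. f u $ i) z = deriv (\<lambda>u. g u $ i) z" for i
    by (rule deriv_cong_ev[OF eventually_mono refl]) simp
  then show ?thesis unfolding vderiv_def by (simp add: vec_eq_iff)
qed

lemma vderiv_scale:
  assumes "vec_holomorphic_on f S" "open S" "z \<in> S" "(c has_field_derivative c') (at z)"
  shows "vderiv (\<lambda>u. c u *s f u) z = c' *s f z + c z *s vderiv f z"
proof -
  have "((\<lambda>u. c u * f u $ i) has_field_derivative (c' * f z $ i + c z * vderiv f z $ i)) (at z)" for i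
    using DERIV_mult[OF assms(4) vec_holomorphic_on_component_derivative[OF assms(1-3)]]
    by (simp add: mult.commute)
  then show ?thesis by (simp add: vec_eq_iff vderiv_def DERIV_imp_deriv)
qed

lemma vderiv_sum:
  assumes "\<And>t. t \<in> A \<Longrightarrow> vec_holomorphic_on (f t) S" "open S" "z \<in> S"
  shows "vderiv (\<lambda>u. \<Sum>t\<in>A. f t u) z = (\<Sum>t\<in>A. vderiv (f t) z)"
proof -
  have "((\<lambda>u. \<Sum>t\<in>A. f t u $ i) has_field_derivative (\<Sum>t\<in>A. vderiv (f t) z $ i)) (at z)" for i
    by (intro DERIV_sum vec_holomorphic_on_component_derivative[OF assms(1) assms(2,3)])
  then show ?thesis by (simp add: vec_eq_iff vderiv_def DERIV_imp_deriv sum_component)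
qed

lemma vec_power_series_holomorphic_extension:
  fixes c :: "nat \<Rightarrow> complex^'n"
  assumes "\<And>z. z \<in> ball 0 r - {0} \<Longrightarrow> (\<lambda>n. (z ^ n) *s c n) sums g z"
  obtains G where "vec_holomorphic_on G (ball 0 r)" "\<And>z. z \<in> ball 0 r - {0} \<Longrightarrow> G z = g z"
proof
  have sums: "(\<lambda>n. c n $ i * z ^ n) sums (g z $ i)" if "z \<in> ball 0 r - {0}" for z i
    using bounded_linear.sums[OF bounded_linear_vec_nth assms[OF that]] by (simp add: mult.commute)
  have "summable (\<lambda>n. c n $ i * z ^ n)" if "norm z < r" for z i
    using sums[of z i] that by (cases "z = 0") (auto simp: sums_iff)
  then show "vec_holomorphic_on (\<lambda>z. \<chi> i. \<Sum>n. c n $ i * z ^ n) (ball 0 r)"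
    unfolding vec_holomorphic_on_def
    by (subst holomorphic_on_open) (auto intro!: exI termdiffs_strong'[of r])
  show "(\<chi> i. \<Sum>n. c n $ i * z ^ n) = g z" if "z \<in> ball 0 r - {0}" for z
    using sums[OF that] by (simp add: vec_eq_iff sums_iff)
qed

lemma sums_vector_scalar_mult: "f sums l \<Longrightarrow> (\<lambda>n. a *s f n) sums (a *s l :: complex^'n)"
  by (rule bounded_linear.sums[OF vec_linear_bounded_linear[OF vec.linear_scale_self]])

lemma laurent_series_holomorphic_shift:
  fixes c :: "nat \<Rightarrow> complex^'n" and k s :: int
  assumes "\<And>n. int n - k < s \<Longrightarrow> c n = 0"
    and "\<And>z. z \<in> ball 0 r - {0} \<Longrightarrow> (\<lambda>n. (z powi (int n - k)) *s c n) sums S z"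
  obtains m where "vec_holomorphic_on m (ball 0 r)"
    "\<And>z. z \<in> ball 0 r - {0} \<Longrightarrow> m z = (z powi (-s)) *s S z"
proof -
  \<comment> \<open>the shift by \<open>J\<close> drops the vanishing coefficients; \<open>z ^ e\<close> is needed when \<open>s + k < 0\<close>\<close>
  define J where "J = nat (s + k)"
  define e where "e = nat (- (s + k))"
  have shifted: "(\<lambda>n. (z ^ n) *s c (n + J)) sums ((inverse (z ^ e) * z powi (-s)) *s S z)"
    if z: "z \<in> ball 0 r - {0}" for z
  proof -
    have "(\<Sum>i<J. (z powi (int i - k)) *s c i) = 0"
      by (rule sum.neutral) (use assms(1) in \<open>auto simp: J_def\<close>)
    then have "(\<lambda>n. (z powi (int (n + J) - k)) *s c (n + J)) sums S z"
      using assms(2)[OF z] sums_iff_shift[where f = "\<lambda>n. (z powi (int n - k)) *s c n" and n = J] by simp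
    then have "(\<lambda>n. (inverse (z ^ e) * z powi (-s)) *s ((z powi (int (n + J) - k)) *s c (n + J)))
                 sums ((inverse (z ^ e) * z powi (-s)) *s S z)"
      by (rule sums_vector_scalar_mult)
    moreover have "inverse (z ^ e) * z powi (-s) * z powi (int (n + J) - k) = z ^ n" for n
    proof -
      have "-s + (int (n + J) - k) = int n + int e" by (simp add: J_def e_def)
      moreover have "z \<noteq> 0" using z by simp
      ultimately have "z powi (-s) * z powi (int (n + J) - k) = z powi (int n + int e)"
        by (metis power_int_add)
      then show ?thesis using \<open>z \<noteq> 0\<close> by (simp add: mult.assoc power_int_add)
    qed
    ultimately show ?thesis by (simp add: vector_smult_assoc)
  qed
  obtain G where G: "vec_holomorphic_on G (ball 0 r)"
    "\<And>z. z \<in> ball 0 r - {0} \<Longrightarrow> G z = (inverse (z ^ e) * z powi (-s)) *s S z"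
    using vec_power_series_holomorphic_extension[OF shifted] by blast
  show ?thesis
  proof
    show "vec_holomorphic_on (\<lambda>z. (z ^ e) *s G z) (ball 0 r)"
      by (rule vec_holomorphic_on_scale[OF _ G(1)]) (auto intro!: holomorphic_intros)
    show "(z ^ e) *s G z = (z powi (-s)) *s S z" if "z \<in> ball 0 r - {0}" for z
      using that by (simp add: G(2) vector_smult_assoc)
  qed
qed

lemma lie_algebra_linear_left: "lie_algebra br \<Longrightarrow> Vector_Spaces.linear (*s) (*s) (\<lambda>x. br x y)"
  by (simp add: lie_algebra_def)

lemma lie_algebra_linear_right: "lie_algebra br \<Longrightarrow> Vector_Spaces.linear (*s) (*s) (br x)"
  by (simp add: lie_algebra_def)

lemma lie_algebra_antisym:
  assumes "lie_algebra br" shows "br x y = - br y x"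
proof -
  have "br x x + br x y + (br y x + br y y) = br (x + y) (x + y)"
    by (simp add: vec.linear_add[OF lie_algebra_linear_left[OF assms]]
        vec.linear_add[OF lie_algebra_linear_right[OF assms]])
  then show ?thesis using assms by (simp add: lie_algebra_def add_eq_0_iff)
qed

lemma subspace_grade:
  assumes "lie_algebra br" shows "vec.subspace (grade br h t)"
  using vec.linear_add[OF lie_algebra_linear_right[OF assms]]
    vec.linear_scale[OF lie_algebra_linear_right[OF assms]]
    vec.linear_0[OF lie_algebra_linear_right[OF assms]]
  unfolding vec.subspace_def grade_def
  by (simp add: vector_add_ldistrib vector_smult_assoc mult.commute)

lemma closed_grade:
  assumes "lie_algebra br" shows "closed (grade br h t)"
proof -
  have "bounded_linear (br h)"
    by (rule vec_linear_bounded_linear[OF lie_algebra_linear_right[OF assms]])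
  moreover have "bounded_linear (\<lambda>x. of_int t *s (x :: complex^'n))"
    by (rule vec_linear_bounded_linear[OF vec.linear_scale_self])
  ultimately show ?thesis
    unfolding grade_def by (intro closed_Collect_eq linear_continuous_on)
qed

lemma sums_in_closed_subspace:
  assumes "closed S" "vec.subspace S" "\<And>n. f n \<in> S" "f sums l"
  shows "l \<in> S"
proof (rule closed_sequentially[OF assms(1)])
  show "(\<lambda>n. sum f {..<n}) \<longlonglongrightarrow> l" using assms(4) by (simp add: sums_def)
  show "sum f {..<n} \<in> S" for n by (rule vec.subspace_sum[OF assms(2)]) (use assms(3) in blast)
qed

lemma bracket_grade:
  assumes "lie_algebra br" "x \<in> grade br h s" "y \<in> grade br h t"
  shows "br x y \<in> grade br h (s + t)"
proof -
  note lin_left = lie_algebra_linear_left[OF assms(1)] and lin_right = lie_algebra_linear_right[OF assms(1)]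
  have "br h (br x y) + br x (br y h) + br y (br h x) = 0"
    using assms(1) by (simp add: lie_algebra_def)
  then have "br h (br x y) = - br x (br y h) - br y (br h x)"
    by (simp add: eq_diff_eq add_ac eq_neg_iff_add_eq_0)
  also have "br y h = - (of_int t *s y)"
    using assms(3) lie_algebra_antisym[OF assms(1), of y h] by (simp add: grade_def)
  also have "br h x = of_int s *s x" using assms(2) by (simp add: grade_def)
  also have "br y (of_int s *s x) = - (of_int s *s br x y)"
    using vec.linear_scale[OF lin_right] lie_algebra_antisym[OF assms(1), of y x] by simp
  also have "br x (- (of_int t *s y)) = - (of_int t *s br x y)"
    by (simp add: vec.linear_neg[OF lin_right] vec.linear_scale[OF lin_right])
  finally show ?thesis by (simp add: grade_def scaleR_add_left vector_sadd_rdistrib add.commute)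
qed

lemma invariant_form_grade_orthogonal:
  assumes "lie_algebra br" "invariant_form br B" "x \<in> grade br h s" "y \<in> grade br h t" "s + t \<noteq> 0"
  shows "B x y = 0"
proof -
  have lin_left: "Vector_Spaces.linear (*s) (*) (\<lambda>x. B x y)" for y
    using assms(2) by (simp add: invariant_form_def cbilinear_def)
  have lin_right: "Vector_Spaces.linear (*s) (*) (B x)" for x
    using assms(2) by (simp add: invariant_form_def cbilinear_def)
  have "of_int t * B x y = B x (br h y)"
    using assms(4) by (simp add: grade_def vs_linear_scale[OF lin_right])
  also have "\<dots> = B (br x h) y" using assms(2) unfolding invariant_form_def by metis
  also have "\<dots> = - (of_int s * B x y)"
    using assms(3) lie_algebra_antisym[OF assms(1), of x h]
    by (simp add: grade_def vs_linear_scale[OF lin_left] vs_linear_neg[OF lin_left])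
  finally have "of_int (s + t) * B x y = 0" by (simp add: algebra_simps)
  then show ?thesis using assms(5) by (metis mult_eq_0_iff of_int_eq_0_iff)
qed

lemma grade_eigenvalue_bound:
  assumes "lie_algebra br"
  obtains K :: int where "\<And>t x. x \<in> grade br h t \<Longrightarrow> x \<noteq> 0 \<Longrightarrow> \<bar>t\<bar> \<le> K"
proof -
  obtain C where C: "\<And>x. norm (br h x) \<le> norm x * C"
    using bounded_linear.bounded[OF vec_linear_bounded_linear[OF lie_algebra_linear_right[OF assms]]]
    by blast
  have "\<bar>t\<bar> \<le> \<lceil>C\<rceil>" if "x \<in> grade br h t" "x \<noteq> 0" for t x
  proof -
    have "norm (br h x) = \<bar>real_of_int t\<bar> * norm x"
      using that(1) by (simp add: grade_def norm_vec_def L2_set_right_distrib norm_mult)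
    then have "\<bar>real_of_int t\<bar> \<le> C" using C[of x] that(2) by (simp add: mult.commute)
    then show ?thesis by linarith
  qed
  then show ?thesis using that by blast
qed

text \<open>\<open>lagrange_projection D s qs\<close> is \<open>\<Prod>q\<leftarrow>qs. (D - q) / (s - q)\<close>, the Lagrange polynomial in \<open>D\<close>
  that kills the eigenvalues in \<open>qs\<close> and fixes the eigenvalue \<open>s\<close>.\<close>

fun lagrange_projection :: "(complex^'n \<Rightarrow> complex^'n) \<Rightarrow> int \<Rightarrow> int list \<Rightarrow> complex^'n \<Rightarrow> complex^'n" where
  "lagrange_projection D s [] v = v"
| "lagrange_projection D s (q # qs) v = (1 / (of_int s - of_int q)) *s
     (D (lagrange_projection D s qs v) - of_int q *s lagrange_projection D s qs v)"

lemma lagrange_projection_linear: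
  assumes "Vector_Spaces.linear (*s) (*s) D"
  shows "Vector_Spaces.linear (*s) (*s) (lagrange_projection D s qs)"
proof (induction qs)
  case Nil
  then show ?case by (simp add: vec.linear_id[unfolded id_def])
next
  case (Cons q qs)
  show ?case unfolding Vector_Spaces.linear_iff
    by (simp add: vec.vector_space_axioms vec.linear_add[OF Cons] vec.linear_scale[OF Cons]
        vec.linear_add[OF assms] vec.linear_scale[OF assms] vec_eq_iff algebra_simps)
qed

lemma lagrange_projection_eigenvector:
  assumes "Vector_Spaces.linear (*s) (*s) D" "D v = of_int t *s v"
  shows "lagrange_projection D s qs v = (\<Prod>q\<leftarrow>qs. (of_int t - of_int q) / (of_int s - of_int q)) *s v"
proof (induction qs)
  case Nil
  then show ?case by simp
next
  case (Cons q qs)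
  then show ?case
    by (simp only: lagrange_projection.simps Cons.IH vec.linear_scale[OF assms(1)] assms(2))
      (simp add: vec_eq_iff divide_inverse algebra_simps)
qed

definition grade_projection ::
  "(complex^'n \<Rightarrow> complex^'n \<Rightarrow> complex^'n) \<Rightarrow> complex^'n \<Rightarrow> int \<Rightarrow> int \<Rightarrow> complex^'n \<Rightarrow> complex^'n" where
  "grade_projection br h K s = lagrange_projection (br h) s (filter (\<lambda>q. q \<noteq> s) [-K..K])"

lemma grade_projection_linear:
  "lie_algebra br \<Longrightarrow> Vector_Spaces.linear (*s) (*s) (grade_projection br h K s)"
  unfolding grade_projection_def by (rule lagrange_projection_linear[OF lie_algebra_linear_right])

lemma grade_projection_grade:
  assumes "lie_algebra br" "\<And>t x. x \<in> grade br h t \<Longrightarrow> x \<noteq> 0 \<Longrightarrow> \<bar>t\<bar> \<le> K"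
    and "x \<in> grade br h q"
  shows "grade_projection br h K s x = (if q = s then x else 0)"
proof (cases "x = 0")
  case True
  then show ?thesis using vec.linear_0[OF grade_projection_linear[OF assms(1)]] by simp
next
  case False
  let ?qs = "filter (\<lambda>q. q \<noteq> s) [-K..K]"
  have "grade_projection br h K s x = (\<Prod>p\<leftarrow>?qs. (of_int q - of_int p) / (of_int s - of_int p)) *s x"
    unfolding grade_projection_def
    by (rule lagrange_projection_eigenvector[OF lie_algebra_linear_right[OF assms(1)]])
      (use assms(3) in \<open>simp add: grade_def\<close>)
  also have "(\<Prod>p\<leftarrow>?qs. (of_int q - of_int p) / (of_int s - of_int p))
      = (\<Prod>p\<in>{-K..K} - {s}. (of_int q - of_int p) / (of_int s - of_int p) :: complex)"
    by (subst prod.distinct_set_conv_list[symmetric]) (auto intro!: prod.cong)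
  also have "\<dots> = (if q = s then 1 else 0)"
    using assms(2)[OF assms(3) False] by (auto intro!: prod.neutral prod_zero)
  finally show ?thesis by simp
qed

lemma grade_projection_span:
  assumes "lie_algebra br" "\<And>t x. x \<in> grade br h t \<Longrightarrow> x \<noteq> 0 \<Longrightarrow> \<bar>t\<bar> \<le> K"
    and "v \<in> vec.span (\<Union>q\<in>A. grade br h q)"
  shows grade_projection_in_grade: "grade_projection br h K s v \<in> grade br h s"
    and sum_grade_projection: "(\<Sum>s\<in>{-K..K}. grade_projection br h K s v) = v"
    and grade_projection_eq_0: "s \<notin> A \<Longrightarrow> grade_projection br h K s v = 0"
proof -
  note lin = grade_projection_linear[OF assms(1)]
  note on_grade = grade_projection_grade[OF assms(1,2)]
  show "grade_projection br h K s v \<in> grade br h s"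
    using assms(3)
  proof (rule vec.span_induct)
    show "vec.subspace {v. grade_projection br h K s v \<in> grade br h s}"
      using vec.linear_subspace_vimage[OF lin subspace_grade[OF assms(1)]] by (simp add: vimage_def)
  qed (auto simp: on_grade vec.subspace_0[OF subspace_grade[OF assms(1)]])
  show "(\<Sum>s\<in>{-K..K}. grade_projection br h K s v) = v"
    using assms(3)
  proof (induction rule: vec.span_induct_alt)
    case base
    then show ?case by (simp add: vec.linear_0[OF lin])
  next
    case (step c x y)
    then obtain q where "x \<in> grade br h q" by blast
    moreover have "q \<in> {-K..K}" if "x \<noteq> 0" using assms(2)[OF \<open>x \<in> grade br h q\<close> that] by auto
    ultimately have "(\<Sum>s\<in>{-K..K}. grade_projection br h K s x) = x"
      by (cases "x = 0") (auto simp: on_grade)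
    with step.IH show ?case
      by (simp add: vec.linear_add[OF lin] vec.linear_scale[OF lin] sum.distrib
          vec.scale_sum_right[symmetric])
  qed
  show "grade_projection br h K s v = 0" if "s \<notin> A"
    using assms(3)
  proof (rule vec.span_induct)
    show "vec.subspace {v. grade_projection br h K s v = 0}" by (rule vec.linear_subspace_kernel[OF lin])
  qed (use that in \<open>auto simp: on_grade\<close>)
qed

lemma graded_laurent_decomposition:
  fixes c :: "nat \<Rightarrow> complex^'n" and k :: int
  assumes "lie_algebra br" "\<And>t x. x \<in> grade br h t \<Longrightarrow> x \<noteq> 0 \<Longrightarrow> \<bar>t\<bar> \<le> K"
    and "\<And>n. c n \<in> vec.span (\<Union>q\<in>{..int n - k}. grade br h q)"
    and "\<And>z. z \<in> ball 0 r - {0} \<Longrightarrow> (\<lambda>n. (z powi (int n - k)) *s c n) sums S z"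
  obtains m where "\<And>s. vec_holomorphic_on (m s) (ball 0 r)"
    "\<And>s z. z \<in> ball 0 r - {0} \<Longrightarrow> m s z \<in> grade br h s"
    "\<And>z. z \<in> ball 0 r - {0} \<Longrightarrow> S z = (\<Sum>s\<in>{-K..K}. z powi s *s m s z)"
proof -
  let ?P = "grade_projection br h K"
  note lin = grade_projection_linear[OF assms(1)]
  have proj_sums: "(\<lambda>n. (z powi (int n - k)) *s ?P s (c n)) sums ?P s (S z)"
    if "z \<in> ball 0 r - {0}" for z s
    using bounded_linear.sums[OF vec_linear_bounded_linear[OF lin] assms(4)[OF that]]
    by (simp add: vec.linear_scale[OF lin])
  have "\<exists>m. vec_holomorphic_on m (ball 0 r) \<and>
          (\<forall>z::complex \<in> ball 0 r - {0}. m z = (z powi (-s)) *s ?P s (S z))" for s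
  proof -
    have "?P s (c n) = 0" if "int n - k < s" for n
      using that by (intro grade_projection_eq_0[OF assms(1-3)]) auto
    then show ?thesis using laurent_series_holomorphic_shift[OF _ proj_sums] by metis
  qed
  then obtain m where m: "\<And>s. vec_holomorphic_on (m s) (ball 0 r)"
    "\<And>s z. z \<in> ball 0 r - {0} \<Longrightarrow> m s z = (z powi (-s)) *s ?P s (S z)"
    by metis
  show ?thesis
  proof (rule that[OF m(1)])
    fix s and z :: complex assume z: "z \<in> ball 0 r - {0}"
    have "?P s (S z) \<in> grade br h s"
      by (rule sums_in_closed_subspace[OF closed_grade[OF assms(1)] subspace_grade[OF assms(1)] _ proj_sums[OF z]])
        (simp add: vec.subspace_scale[OF subspace_grade[OF assms(1)]] grade_projection_in_grade[OF assms(1-3)])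
    then show "m s z \<in> grade br h s"
      by (simp add: m(2)[OF z] vec.subspace_scale[OF subspace_grade[OF assms(1)]])
  next
    fix z :: complex assume z: "z \<in> ball 0 r - {0}"
    have "(\<lambda>n. \<Sum>s\<in>{-K..K}. (z powi (int n - k)) *s ?P s (c n)) sums (\<Sum>s\<in>{-K..K}. ?P s (S z))"
      by (intro sums_sum proj_sums[OF z])
    then have "(\<lambda>n. (z powi (int n - k)) *s c n) sums (\<Sum>s\<in>{-K..K}. ?P s (S z))"
      by (simp add: vec.scale_sum_right[symmetric] sum_grade_projection[OF assms(1-3)])
    then have "S z = (\<Sum>s\<in>{-K..K}. ?P s (S z))" using assms(4)[OF z] by (simp add: sums_unique2)
    also have "\<dots> = (\<Sum>s\<in>{-K..K}. z powi s *s m s z)"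
      using z by (simp add: m(2) power_int_minus vector_smult_assoc)
    finally show "S z = (\<Sum>s\<in>{-K..K}. z powi s *s m s z)" .
  qed
qed

lemma vderiv_in_grade:
  assumes "lie_algebra br" "vec_holomorphic_on f S" "open S" "z \<in> S"
    and "\<And>u. u \<in> S \<Longrightarrow> f u \<in> grade br h t"
  shows "vderiv f z \<in> grade br h t"
proof -
  have "br h (vderiv f z) = vderiv (\<lambda>u. br h (f u)) z"
    by (rule vderiv_linear[OF lie_algebra_linear_right[OF assms(1)] assms(2-4), symmetric])
  also have "\<dots> = vderiv (\<lambda>u. of_int t *s f u) z"
    by (rule vderiv_cong[OF assms(3,4)]) (use assms(5) in \<open>simp add: grade_def\<close>)
  also have "\<dots> = of_int t *s vderiv f z"
    by (rule vderiv_linear[OF vec.linear_scale_self assms(2-4)])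
  finally show ?thesis by (simp add: grade_def)
qed

text \<open>On the summand of degree \<open>t\<close> the pole \<open>h / z\<close> acts as \<open>t / z\<close>, which cancels the derivative
  of \<open>z powi t\<close>.\<close>

lemma vderiv_minus_bracket_graded_sum:
  fixes m :: "int \<Rightarrow> complex \<Rightarrow> complex^'n"
  assumes "lie_algebra br" "open S" "0 \<notin> S" "z \<in> S"
    and "\<And>t. vec_holomorphic_on (m t) S" "\<And>t. m t z \<in> grade br h t"
  shows "vderiv (\<lambda>u. \<Sum>t\<in>Q. u powi t *s m t u) z - br ((1 / z) *s h + w) (\<Sum>t\<in>Q. z powi t *s m t z)
         = (\<Sum>t\<in>Q. z powi t *s (vderiv (m t) z - br w (m t z)))"
proof -
  note lin_left = lie_algebra_linear_left[OF assms(1)] and lin_right = lie_algebra_linear_right[OF assms(1)]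
  have z0: "z \<noteq> 0" using assms(3,4) by auto
  have "vderiv (\<lambda>u. u powi t *s m t u) z = (of_int t * z powi (t - 1)) *s m t z + z powi t *s vderiv (m t) z" for t
  proof -
    have "((\<lambda>u. u powi t) has_field_derivative (of_int t * z powi (t - 1))) (at z)"
      using DERIV_power_int[OF DERIV_ident, where n = t] z0 by auto
    then show ?thesis by (rule vderiv_scale[OF assms(5) assms(2,4)])
  qed
  moreover have "vec_holomorphic_on (\<lambda>u. u powi t *s m t u) S" for t
    using assms(3) by (intro vec_holomorphic_on_scale[OF _ assms(5)]) (auto intro!: holomorphic_intros)
  ultimately have derivative: "vderiv (\<lambda>u. \<Sum>t\<in>Q. u powi t *s m t u) z
      = (\<Sum>t\<in>Q. (of_int t * z powi (t - 1)) *s m t z + z powi t *s vderiv (m t) z)"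
    by (simp add: vderiv_sum[OF _ assms(2,4)])
  have "br ((1 / z) *s h + w) (m t z) = (of_int t / z) *s m t z + br w (m t z)" for t
    using assms(6)[of t]
    by (simp add: vec.linear_add[OF lin_left] vec.linear_scale[OF lin_left] grade_def vector_smult_assoc)
  then have bracket: "br ((1 / z) *s h + w) (\<Sum>t\<in>Q. z powi t *s m t z)
      = (\<Sum>t\<in>Q. z powi t *s ((of_int t / z) *s m t z + br w (m t z)))"
    by (simp add: vec.linear_sum[OF lin_right] vec.linear_scale[OF lin_right])
  have "z powi (t - 1) = z powi t / z" for t using z0 by (simp add: power_int_diff)
  then show ?thesis
    unfolding derivative bracket
    by (simp add: sum_subtractf[symmetric] vec_eq_iff algebra_simps)
qed

lemma invariant_form_graded_sums:
  assumes "lie_algebra br" "invariant_form br B" "z \<noteq> 0"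
    and "\<And>s. x s \<in> grade br h s" "\<And>t. y t \<in> grade br h t"
  shows "B (\<Sum>s\<in>{-K..K}. z powi s *s x s) (\<Sum>t\<in>{-K..K}. z powi t *s y t)
         = (\<Sum>s\<in>{-K..K}. B (x s) (y (- s)))"
proof -
  have lin_left: "Vector_Spaces.linear (*s) (*) (\<lambda>x. B x y)" for y
    using assms(2) by (simp add: invariant_form_def cbilinear_def)
  have lin_right: "Vector_Spaces.linear (*s) (*) (B x)" for x
    using assms(2) by (simp add: invariant_form_def cbilinear_def)
  have "B (\<Sum>s\<in>{-K..K}. z powi s *s x s) (\<Sum>t\<in>{-K..K}. z powi t *s y t)
      = (\<Sum>s\<in>{-K..K}. \<Sum>t\<in>{-K..K}. z powi s * z powi t * B (x s) (y t))"
    by (simp add: vs_linear_sum[OF lin_left] vs_linear_sum[OF lin_right] vs_linear_scale[OF lin_left]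
        vs_linear_scale[OF lin_right] sum_distrib_left mult.assoc)
      (subst sum.swap, simp add: mult.left_commute)
  also have "\<dots> = (\<Sum>s\<in>{-K..K}. \<Sum>t\<in>{-K..K}. if t = - s then B (x s) (y (- s)) else 0)"
    using invariant_form_grade_orthogonal[OF assms(1,2,4,5)] assms(3)
    by (intro sum.cong refl) (auto simp: power_int_minus)
  finally show ?thesis by simp
qed

lemma invariant_pairing_covariant_derivative_holomorphic:
  fixes mL mR :: "int \<Rightarrow> complex \<Rightarrow> complex^'n" and W :: "complex \<Rightarrow> complex^'n" and K :: int
  assumes "lie_algebra br" "invariant_form br B"
    and "\<And>s. vec_holomorphic_on (mL s) (ball 0 r)" "\<And>s z. z \<in> ball 0 r - {0} \<Longrightarrow> mL s z \<in> grade br h s"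
    and "\<And>s. vec_holomorphic_on (mR s) (ball 0 r)" "\<And>s z. z \<in> ball 0 r - {0} \<Longrightarrow> mR s z \<in> grade br h s"
    and "vec_holomorphic_on W (ball 0 r)" "\<And>z. z \<in> ball 0 r - {0} \<Longrightarrow> W z \<in> grade br h 0"
  defines "L \<equiv> \<lambda>z. \<Sum>s\<in>{-K..K}. z powi s *s mL s z" and "L' \<equiv> \<lambda>z. \<Sum>s\<in>{-K..K}. z powi s *s mR s z"
  shows "\<exists>F. F holomorphic_on ball 0 r \<and>
    (\<forall>z \<in> ball 0 r - {0}. F z = B (L z) (vderiv L' z - br ((1 / z) *s h + W z) (L' z)))"
proof (intro exI conjI ballI)
  define Y where "Y t z = vderiv (mR t) z - br (W z) (mR t z)" for t z
  show "(\<lambda>z. \<Sum>s\<in>{-K..K}. B (mL s z) (Y (- s) z)) holomorphic_on ball 0 r"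
  proof (rule holomorphic_on_sum)
    have B_linear: "Vector_Spaces.linear (*s) (*) (\<lambda>x. B x y)" "Vector_Spaces.linear (*s) (*) (B x)" for x y
      using assms(2) by (simp_all add: invariant_form_def cbilinear_def)
    have "vec_holomorphic_on (Y t) (ball 0 r)" for t
      unfolding Y_def
      by (rule vec_holomorphic_on_diff[OF vec_holomorphic_on_vderiv[OF open_ball assms(5)]
            vec_holomorphic_on_bilinear[OF lie_algebra_linear_left[OF assms(1)]
              lie_algebra_linear_right[OF assms(1)] assms(7,5)]])
    then show "(\<lambda>z. B (mL s z) (Y (- s) z)) holomorphic_on ball 0 r" for s
      by (rule holomorphic_on_bilinear[OF B_linear assms(3)])
  qed
  fix z :: complex assume z: "z \<in> ball 0 r - {0}"
  have "Y t z \<in> grade br h t" for t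
  proof -
    have "vderiv (mR t) z \<in> grade br h t"
      using vderiv_in_grade[OF assms(1) vec_holomorphic_on_subset[OF assms(5)] _ z assms(6)] by auto
    moreover have "br (W z) (mR t z) \<in> grade br h t"
      using bracket_grade[OF assms(1) assms(8)[OF z] assms(6)[OF z]] by simp
    ultimately show ?thesis unfolding Y_def by (rule vec.subspace_diff[OF subspace_grade[OF assms(1)]])
  qed
  moreover have "vderiv L' z - br ((1 / z) *s h + W z) (L' z) = (\<Sum>t\<in>{-K..K}. z powi t *s Y t z)"
    unfolding Y_def L'_def
    by (rule vderiv_minus_bracket_graded_sum[OF assms(1) _ _ z vec_holomorphic_on_subset[OF assms(5)]
          assms(6)[OF z]]) auto
  ultimately show "(\<Sum>s\<in>{-K..K}. B (mL s z) (Y (- s) z)) = B (L z) (vderiv L' z - br ((1 / z) *s h + W z) (L' z))"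
    unfolding L_def
    using invariant_form_graded_sums[OF assms(1,2), of z "\<lambda>s. mL s z" h "\<lambda>t. Y t z" K] assms(4)[OF z] z
    by simp
qed

theorem theorem2p2:
  fixes br :: "complex^'n \<Rightarrow> complex^'n \<Rightarrow> complex^'n"
    and B :: "complex^'n \<Rightarrow> complex^'n \<Rightarrow> complex"
    and H :: "(complex^'n) set" and h :: "complex^'n"
    and r :: real
    and L L' w :: "complex \<Rightarrow> complex^'n"
    and a b om :: "nat \<Rightarrow> complex^'n"
  assumes "semisimple_lie br"
    and "grading_element br H h"
    and "invariant_form br B"
    and "r > 0"
    and "\<forall>n. a n \<in> filtration br h (int n - grading_depth br h)"
    and "\<forall>n. b n \<in> filtration br h (int n - grading_depth br h)"
    and "\<forall>z. 0 < norm z \<and> norm z < r \<longrightarrow>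
           (\<lambda>n. (z powi (int n - grading_depth br h)) *s a n) sums L z"
    and "\<forall>z. 0 < norm z \<and> norm z < r \<longrightarrow>
           (\<lambda>n. (z powi (int n - grading_depth br h)) *s b n) sums L' z"
    and "\<forall>l. om l \<in> grade br h 0"
    and "\<forall>z. 0 < norm z \<and> norm z < r \<longrightarrow>
           (\<lambda>l. (z ^ l) *s om l) sums (w z - (1 / z) *s h)"
  shows "\<exists>f. f holomorphic_on ball 0 r \<and>
           (\<forall>z. 0 < norm z \<and> norm z < r \<longrightarrow>
              f z = B (L z) (vderiv L' z - br (w z) (L' z)))"
proof -
  \<comment> \<open>only the bracket is needed from semisimplicity\<close>
  have la: "lie_algebra br" using assms(1) by (simp add: semisimple_lie_def)
  obtain K where K: "\<And>t x. x \<in> grade br h t \<Longrightarrow> x \<noteq> 0 \<Longrightarrow> \<bar>t\<bar> \<le> K"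
    using grade_eigenvalue_bound[OF la] by blast
  let ?D = "ball 0 r - {0}"
  have punctured: "0 < norm z \<and> norm z < r \<longleftrightarrow> z \<in> ?D" for z :: complex by auto
  have filtered: "filtration br h p \<subseteq> vec.span (\<Union>q\<in>{..p}. grade br h q)" for p
    unfolding filtration_def by (intro vec.span_mono) auto
  obtain mL where mL: "\<And>s. vec_holomorphic_on (mL s) (ball 0 r)"
    "\<And>s z. z \<in> ?D \<Longrightarrow> mL s z \<in> grade br h s" "\<And>z. z \<in> ?D \<Longrightarrow> L z = (\<Sum>s\<in>{-K..K}. z powi s *s mL s z)"
    by (rule graded_laurent_decomposition[OF la K]) (use assms(5,7) punctured in \<open>auto intro: subsetD[OF filtered]\<close>)
  obtain mR where mR: "\<And>s. vec_holomorphic_on (mR s) (ball 0 r)"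
    "\<And>s z. z \<in> ?D \<Longrightarrow> mR s z \<in> grade br h s" "\<And>z. z \<in> ?D \<Longrightarrow> L' z = (\<Sum>s\<in>{-K..K}. z powi s *s mR s z)"
    by (rule graded_laurent_decomposition[OF la K]) (use assms(6,8) punctured in \<open>auto intro: subsetD[OF filtered]\<close>)
  obtain W where W: "vec_holomorphic_on W (ball 0 r)" "\<And>z. z \<in> ?D \<Longrightarrow> W z = w z - (1 / z) *s h"
    by (rule vec_power_series_holomorphic_extension) (use assms(10) punctured in auto)
  have "W z \<in> grade br h 0" if "z \<in> ?D" for z
    using sums_in_closed_subspace[OF closed_grade[OF la] subspace_grade[OF la] _ assms(10)[rule_format]] that
    by (simp add: W(2) assms(9) vec.subspace_scale[OF subspace_grade[OF la]])
  then obtain F where F: "F holomorphic_on ball 0 r" "\<And>z. z \<in> ?D \<Longrightarrow> F z = B (L z)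
      (vderiv (\<lambda>u. \<Sum>s\<in>{-K..K}. u powi s *s mR s u) z - br ((1 / z) *s h + W z) (L' z))"
    using invariant_pairing_covariant_derivative_holomorphic[OF la assms(3) mL(1,2) mR(1,2) W(1), of K]
    by (auto simp: mL(3) mR(3))
  have "vderiv L' z = vderiv (\<lambda>u. \<Sum>s\<in>{-K..K}. u powi s *s mR s u) z" if "z \<in> ?D" for z
    by (rule vderiv_cong[OF _ that mR(3)]) auto
  then show ?thesis using F W(2) punctured by (intro exI[of _ F]) auto
qed

end
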